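(* The following polynomial-time algorithm is an $(\ell+1)$-approximation algorithm for non-preemptive \textsf{MAXCONNECTIVITY} on general graphs, where $\ell\le|E|$ is the number of distinct values $d_e-p_e$, $e\in E$: let $t_1<\dots<t_\ell$ be the distinct values $d_e-p_e$, and $t_{\ell+1}=T$; for each $i=1,\dots,\ell+1$, let $S_i$ be the non-preemptive schedule in which every edge $e$ with $d_e-p_e<t_i$ starts maintenance at $r_e$ and every other edge starts maintenance at $d_e-p_e$; output the schedule $S_i$ with the largest total connectivity time.
   Context: An instance consists of an undirected graph $G=(V,E)$ with distinguished vertices $s^+,s^-\in V$ and, for every edge $e$, a maintenance job with processing time $p_e\in\mathbb{Z}_{\ge0}$, release date $r_e\in\mathbb{Z}_{\ge0}$ and deadline $d_e\in\mathbb{Z}_{\ge0}$ (with $r_e+p_e\le d_e$). A non-preemptive schedule assigns to each edge $e$ a single interval $[a_e,a_e+p_e]\subseteq[r_e,d_e]$, during which $e$ is unavailable; arbitrarily many edges may be maintained simultaneously. Time horizon $T=\max_e d_e$. The network is connected at time $t$ if there is an $s^+$–$s^-$ path of edges not maintained at $t$. The total connectivity time of a schedule is the measure of times in $[0,T]$ at which the network is connected; \textsf{MAXCONNECTIVITY} maximizes it. An $\alpha$-approximation algorithm returns a feasible schedule whose value is at least $1/\alpha$ times the optimum. *)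

theory Defs
  imports
    "HOL-Analysis.Analysis"
    "HOL-Library.Log_Nat"
    "HOL-Library.Monad_Syntax"
    "HOL-Computational_Algebra.Polynomial"
begin

section \<open>Instances and schedules\<close>

text \<open>
  Edges are named by elements of an arbitrary type and \<open>ends\<close> gives the unordered pair of endpoints,
  so parallel edges with different jobs are allowed; a simple graph is the case where \<open>ends\<close> is
  the identity on a set of two-element vertex sets.
\<close>

record ('v, 'e) maint_instance =
  verts :: "'v set"
  edges :: "'e set"
  ends :: "'e \<Rightarrow> 'v set"
  splus :: 'v
  sminus :: 'v
  ptime :: "'e \<Rightarrow> nat"
  release :: "'e \<Rightarrow> nat"
  deadline :: "'e \<Rightarrow> nat"

definition wf_instance :: "('v, 'e) maint_instance \<Rightarrow> bool" where
  "wf_instance I \<longleftrightarrow>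
     finite (verts I) \<and> finite (edges I) \<and> splus I \<in> verts I \<and> sminus I \<in> verts I \<and>
     (\<forall>e\<in>edges I. ends I e \<subseteq> verts I \<and> card (ends I e) = 2 \<and>
                  release I e + ptime I e \<le> deadline I e)"

text \<open>The time horizon is the largest deadline; for a graph without edges it is taken to be 0.\<close>

definition horizon :: "('v, 'e) maint_instance \<Rightarrow> nat" where
  "horizon I = (if edges I = {} then 0 else Max (deadline I ` edges I))"

text \<open>A schedule gives the (real) start time \<open>a e\<close> of the maintenance of each edge \<open>e\<close>.\<close>

definition feasible :: "('v, 'e) maint_instance \<Rightarrow> ('e \<Rightarrow> real) \<Rightarrow> bool" where
  "feasible I a \<longleftrightarrow>
     (\<forall>e\<in>edges I. {a e .. a e + real (ptime I e)} \<subseteq> {real (release I e) .. real (deadline I e)})"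

definition available :: "('v, 'e) maint_instance \<Rightarrow> ('e \<Rightarrow> real) \<Rightarrow> real \<Rightarrow> 'e set" where
  "available I a t = {e \<in> edges I. t \<notin> {a e .. a e + real (ptime I e)}}"

definition is_path :: "('v, 'e) maint_instance \<Rightarrow> 'e set \<Rightarrow> 'v \<Rightarrow> 'v list \<Rightarrow> 'v \<Rightarrow> bool" where
  "is_path I F u ws v \<longleftrightarrow>
     ws \<noteq> [] \<and> hd ws = u \<and> last ws = v \<and> distinct ws \<and> set ws \<subseteq> verts I \<and>
     (\<forall>k. Suc k < length ws \<longrightarrow> (\<exists>e\<in>F. ends I e = {ws ! k, ws ! Suc k}))"

definition connected_at :: "('v, 'e) maint_instance \<Rightarrow> ('e \<Rightarrow> real) \<Rightarrow> real \<Rightarrow> bool" where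
  "connected_at I a t \<longleftrightarrow> (\<exists>ws. is_path I (available I a t) (splus I) ws (sminus I))"

definition conn_time :: "('v, 'e) maint_instance \<Rightarrow> ('e \<Rightarrow> real) \<Rightarrow> real" where
  "conn_time I a = measure lborel {t \<in> {0 .. real (horizon I)}. connected_at I a t}"

definition opt :: "('v, 'e) maint_instance \<Rightarrow> real" where
  "opt I = (SUP a \<in> {a. feasible I a}. conn_time I a)"

definition approx_solution :: "real \<Rightarrow> ('v, 'e) maint_instance \<Rightarrow> ('e \<Rightarrow> real) \<Rightarrow> bool" where
  "approx_solution \<alpha> I a \<longleftrightarrow> feasible I a \<and> conn_time I a \<ge> 1 / \<alpha> * opt I"

section \<open>The candidate schedules\<close>

text \<open>For a well-formed instance \<open>ptime I e \<le> deadline I e\<close>, so the subtraction is not truncated.\<close>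

definition latest_start :: "('v, 'e) maint_instance \<Rightarrow> 'e \<Rightarrow> nat" where
  "latest_start I e = deadline I e - ptime I e"

definition num_latest :: "('v, 'e) maint_instance \<Rightarrow> nat" where
  "num_latest I = card (latest_start I ` edges I)"

text \<open>
  \<open>threshold I i\<close> is the \<open>i\<close>-th smallest latest start time for \<open>1 \<le> i \<le> num_latest I\<close>
  (counting from 1) and the horizon for \<open>i = num_latest I + 1\<close>.
\<close>

definition threshold :: "('v, 'e) maint_instance \<Rightarrow> nat \<Rightarrow> nat" where
  "threshold I i =
     (if i \<le> num_latest I then sorted_list_of_set (latest_start I ` edges I) ! (i - 1)
      else horizon I)"

definition cand :: "('v, 'e) maint_instance \<Rightarrow> nat \<Rightarrow> 'e \<Rightarrow> real" where
  "cand I i e = (if latest_start I e < threshold I i then real (release I e)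
                 else real (latest_start I e))"

definition best_index :: "('v, 'e) maint_instance \<Rightarrow> nat \<Rightarrow> bool" where
  "best_index I i \<longleftrightarrow> i \<in> {1..num_latest I + 1} \<and>
     (\<forall>j\<in>{1..num_latest I + 1}. conn_time I (cand I j) \<le> conn_time I (cand I i))"

section \<open>Computations with a cost\<close>

text \<open>
  A costed computation is a result together with the number of steps used.  The algorithm below is
  written with the following primitives only: adding, subtracting and comparing natural numbers,
  charged by the binary lengths of the operands; comparing two vertices, charged 1; and \<open>ret\<close>,
  charged 1, for assembling a result from already available values by constructors,
  field selections and case distinctions.  Sequencing adds the costs, and every function call ends
  in a \<open>ret\<close> or a primitive, so that each call is charged at least 1.
\<close>

type_synonym 'a costed = "'a \<times> nat"

definition ret :: "'a \<Rightarrow> 'a costed" where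
  "ret x = (x, 1)"

definition bind_costed :: "'a costed \<Rightarrow> ('a \<Rightarrow> 'b costed) \<Rightarrow> 'b costed" where
  "bind_costed m f = (fst (f (fst m)), snd m + snd (f (fst m)))"

adhoc_overloading Monad_Syntax.bind \<rightleftharpoons> bind_costed

abbreviation result :: "'a costed \<Rightarrow> 'a" where "result \<equiv> fst"
abbreviation steps :: "'a costed \<Rightarrow> nat" where "steps \<equiv> snd"

definition bits :: "nat \<Rightarrow> nat" where
  "bits n = floorlog 2 n"

definition addC :: "nat \<Rightarrow> nat \<Rightarrow> nat costed" where
  "addC m n = (m + n, 1 + bits m + bits n)"

definition subC :: "nat \<Rightarrow> nat \<Rightarrow> nat costed" where
  "subC m n = (m - n, 1 + bits m + bits n)"

definition lessC :: "nat \<Rightarrow> nat \<Rightarrow> bool costed" where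
  "lessC m n = (m < n, 1 + bits m + bits n)"

definition veqC :: "'v \<Rightarrow> 'v \<Rightarrow> bool costed" where
  "veqC u v = (u = v, 1)"

primrec mapC :: "('a \<Rightarrow> 'b costed) \<Rightarrow> 'a list \<Rightarrow> 'b list costed" where
  "mapC f [] = ret []"
| "mapC f (x # xs) = do { y \<leftarrow> f x; ys \<leftarrow> mapC f xs; ret (y # ys) }"

primrec filterC :: "('a \<Rightarrow> bool costed) \<Rightarrow> 'a list \<Rightarrow> 'a list costed" where
  "filterC P [] = ret []"
| "filterC P (x # xs) =
     do { b \<leftarrow> P x; ys \<leftarrow> filterC P xs; ret (if b then x # ys else ys) }"

primrec foldC :: "('a \<Rightarrow> 'b \<Rightarrow> 'b costed) \<Rightarrow> 'a list \<Rightarrow> 'b \<Rightarrow> 'b costed" where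
  "foldC f [] s = ret s"
| "foldC f (x # xs) s = do { s' \<leftarrow> f x s; foldC f xs s' }"

primrec snocC :: "'a list \<Rightarrow> 'a \<Rightarrow> 'a list costed" where
  "snocC [] y = ret [y]"
| "snocC (x # xs) y = do { zs \<leftarrow> snocC xs y; ret (x # zs) }"

primrec memC :: "'v \<Rightarrow> 'v list \<Rightarrow> bool costed" where
  "memC v [] = ret False"
| "memC v (w # ws) = do { b \<leftarrow> veqC v w; if b then ret True else memC v ws }"

text \<open>Insertion into a strictly increasing list, leaving the list unchanged on duplicates.\<close>

primrec insertC :: "nat \<Rightarrow> nat list \<Rightarrow> nat list costed" where
  "insertC x [] = ret [x]"
| "insertC x (y # ys) = do {
     lt \<leftarrow> lessC x y;
     if lt then ret (x # y # ys)
     else do {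
       gt \<leftarrow> lessC y x;
       if gt then do { zs \<leftarrow> insertC x ys; ret (y # zs) } else ret (y # ys) } }"

section \<open>The algorithm\<close>

record ('v, 'e) job =
  jid :: 'e
  jend1 :: 'v
  jend2 :: 'v
  jproc :: nat
  jrel :: nat
  jdead :: nat

record ('v, 'e) input =
  vlist :: "'v list"
  jobs :: "('v, 'e) job list"
  source :: 'v
  target :: 'v

definition encodes :: "('v, 'e) input \<Rightarrow> ('v, 'e) maint_instance \<Rightarrow> bool" where
  "encodes x I \<longleftrightarrow>
     distinct (vlist x) \<and> set (vlist x) = verts I \<and>
     distinct (map jid (jobs x)) \<and> set (map jid (jobs x)) = edges I \<and>
     source x = splus I \<and> target x = sminus I \<and>
     (\<forall>j\<in>set (jobs x). ends I (jid j) = {jend1 j, jend2 j} \<and> ptime I (jid j) = jproc j \<and>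
        release I (jid j) = jrel j \<and> deadline I (jid j) = jdead j)"

text \<open>Numbers count with their binary length, vertices and edge names as one symbol each.\<close>

definition input_size :: "('v, 'e) input \<Rightarrow> nat" where
  "input_size x = length (vlist x) +
     (\<Sum>j\<leftarrow>jobs x. 1 + bits (jproc j) + bits (jrel j) + bits (jdead j))"

definition latestC :: "('v, 'e) job \<Rightarrow> nat costed" where
  "latestC j = subC (jdead j) (jproc j)"

definition horizonC :: "('v, 'e) job list \<Rightarrow> nat costed" where
  "horizonC js = foldC (\<lambda>j m. do { b \<leftarrow> lessC m (jdead j); ret (if b then jdead j else m) }) js 0"

text \<open>The list \<open>t\<^sub>1, \<dots>, t\<^sub>\<ell>, T\<close>, where \<open>T\<close> is the horizon.\<close>

definition thresholdsC :: "('v, 'e) job list \<Rightarrow> nat \<Rightarrow> nat list costed" where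
  "thresholdsC js T = do {
     ts \<leftarrow> foldC (\<lambda>j ts. do { l \<leftarrow> latestC j; insertC l ts }) js [];
     snocC ts T }"

definition candC :: "('v, 'e) job list \<Rightarrow> nat \<Rightarrow> (('v, 'e) job \<times> nat) list costed" where
  "candC js t = mapC (\<lambda>j. do {
     l \<leftarrow> latestC j;
     b \<leftarrow> lessC l t;
     ret (j, if b then jrel j else l) }) js"

text \<open>One round extends the set \<open>R\<close> of reached vertices along each of the jobs' edges.\<close>

definition roundC :: "('v, 'e) job list \<Rightarrow> 'v list \<Rightarrow> 'v list costed" where
  "roundC js R = foldC (\<lambda>j R. do {
     b1 \<leftarrow> memC (jend1 j) R;
     b2 \<leftarrow> memC (jend2 j) R;
     ret (if b1 \<and> \<not> b2 then jend2 j # R else if b2 \<and> \<not> b1 then jend1 j # R else R) }) js R"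

definition reachC :: "('v, 'e) input \<Rightarrow> ('v, 'e) job list \<Rightarrow> bool costed" where
  "reachC x js = do {
     R \<leftarrow> foldC (\<lambda>_ R. roundC js R) (vlist x) [source x];
     memC (target x) R }"

text \<open>
  Between two consecutive event times \<open>a < b\<close> the job started at \<open>s\<close> is being processed throughout
  the open interval if \<open>s \<le> a < s + p\<close> and nowhere in it otherwise.
\<close>

definition freeC :: "nat \<Rightarrow> ('v, 'e) job \<times> nat \<Rightarrow> bool costed" where
  "freeC a js = do {
     notyet \<leftarrow> lessC a (snd js);
     c \<leftarrow> addC (snd js) (jproc (fst js));
     running \<leftarrow> lessC a c;
     ret (notyet \<or> \<not> running) }"

definition connectedC :: "('v, 'e) input \<Rightarrow> (('v, 'e) job \<times> nat) list \<Rightarrow> nat \<Rightarrow> bool costed" where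
  "connectedC x S a = do {
     free \<leftarrow> filterC (freeC a) S;
     js \<leftarrow> mapC (\<lambda>js. ret (fst js)) free;
     reachC x js }"

definition eventsC :: "(('v, 'e) job \<times> nat) list \<Rightarrow> nat \<Rightarrow> nat list costed" where
  "eventsC S T = do {
     ev0 \<leftarrow> insertC T [0];
     foldC (\<lambda>js ev. do {
       c \<leftarrow> addC (snd js) (jproc (fst js));
       ev1 \<leftarrow> insertC (snd js) ev;
       insertC c ev1 }) S ev0 }"

fun sweepC :: "('v, 'e) input \<Rightarrow> (('v, 'e) job \<times> nat) list \<Rightarrow> nat list \<Rightarrow> nat costed" where
  "sweepC x S (a # b # ev) = do {
     conn \<leftarrow> connectedC x S a;
     n \<leftarrow> sweepC x S (b # ev);
     if conn then do { l \<leftarrow> subC b a; addC l n } else ret n }"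
| "sweepC x S _ = ret 0"

definition conn_timeC :: "('v, 'e) input \<Rightarrow> nat \<Rightarrow> (('v, 'e) job \<times> nat) list \<Rightarrow> nat costed" where
  "conn_timeC x T S = do { ev \<leftarrow> eventsC S T; sweepC x S ev }"

definition evaluateC ::
    "('v, 'e) input \<Rightarrow> nat \<Rightarrow> nat \<Rightarrow> ((('v, 'e) job \<times> nat) list \<times> nat) costed" where
  "evaluateC x T t = do {
     S \<leftarrow> candC (jobs x) t;
     n \<leftarrow> conn_timeC x T S;
     ret (S, n) }"

definition best_candidate :: "('v, 'e) input \<Rightarrow> ('e \<times> nat) list costed" where
  "best_candidate x = do {
     T \<leftarrow> horizonC (jobs x);
     ts \<leftarrow> thresholdsC (jobs x) T;
     first \<leftarrow> evaluateC x T (hd ts);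
     best \<leftarrow> foldC (\<lambda>t best. do {
       new \<leftarrow> evaluateC x T t;
       better \<leftarrow> lessC (snd best) (snd new);
       ret (if better then new else best) }) (tl ts) first;
     mapC (\<lambda>js. ret (jid (fst js), snd js)) (fst best) }"

section \<open>Polynomial-time approximation algorithms\<close>

text \<open>
  An algorithm maps an encoded instance to a list that pairs every edge name with its start time; \<open>schedule_of\<close> reads
  the list as a schedule.
\<close>

definition schedule_of :: "('e \<times> nat) list \<Rightarrow> 'e \<Rightarrow> real" where
  "schedule_of out e = real (the (map_of out e))"

definition approx_algorithm ::
    "(('v, 'e) maint_instance \<Rightarrow> real) \<Rightarrow> (('v, 'e) input \<Rightarrow> ('e \<times> nat) list costed) \<Rightarrow> bool" where
  "approx_algorithm \<alpha> A \<longleftrightarrow>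
     (\<forall>I x. wf_instance I \<longrightarrow> encodes x I \<longrightarrow>
        distinct (map fst (result (A x))) \<and> fst ` set (result (A x)) = edges I \<and>
        approx_solution (\<alpha> I) I (schedule_of (result (A x))))"

definition polynomial_time :: "(('v, 'e) input \<Rightarrow> ('e \<times> nat) list costed) \<Rightarrow> bool" where
  "polynomial_time A \<longleftrightarrow>
     (\<exists>q :: nat poly. \<forall>I x. wf_instance I \<longrightarrow> encodes x I \<longrightarrow>
        steps (A x) \<le> poly q (input_size x))"

end

theory Submission
  imports Defs
begin

text \<open>
  Let \<open>t\<close> be a time that is not a threshold and let \<open>\<theta>\<close> be the least threshold above \<open>t\<close>. In the
  candidate for \<open>\<theta>\<close>, an edge whose latest start is at least \<open>\<theta>\<close> has not started at time \<open>t\<close>. Every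
  other edge has its latest start before \<open>t\<close>, so in any feasible schedule in which it is available at
  \<open>t\<close> it has already finished by then, and all the more so when started at its release date. Hence at
  almost every time at which some feasible schedule is connected, one of the \<open>\<ell> + 1\<close> candidates is
  connected, and by the union bound the best candidate is connected for at least a fraction
  \<open>1 / (\<ell> + 1)\<close> of the optimum.

  The algorithm computes connectivity times exactly because the set of available edges is constant
  between consecutive event times.
\<close>

section \<open>Connectivity and its measure\<close>

text \<open>Separates the graph part of connectivity from time: a schedule enters only through the
  set of available edges.\<close>

definition joined :: "('v, 'e) maint_instance \<Rightarrow> 'e set \<Rightarrow> bool" where
  "joined I F \<longleftrightarrow> (\<exists>ws. is_path I F (splus I) ws (sminus I))"

definition adjacency :: "('v, 'e) maint_instance \<Rightarrow> 'e set \<Rightarrow> ('v \<times> 'v) set" where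
  "adjacency I F = {(u, v). \<exists>e\<in>F. ends I e = {u, v}}"

lemma connected_at_joined: "connected_at I a t \<longleftrightarrow> joined I (available I a t)"
  by (simp add: connected_at_def joined_def)

lemma joined_mono: "joined I F \<Longrightarrow> F \<subseteq> G \<Longrightarrow> joined I G"
  unfolding joined_def is_path_def by (meson subsetD)

lemma is_path_imp_rtrancl: "is_path I F u ws v \<Longrightarrow> (u, v) \<in> (adjacency I F)\<^sup>*"
proof (induction ws arbitrary: v rule: rev_induct)
  case Nil
  then show ?case by (simp add: is_path_def)
next
  case (snoc w ws)
  show ?case
  proof (cases "ws = []")
    case True
    with snoc.prems show ?thesis by (auto simp: is_path_def)
  next
    case False
    have edge: "\<exists>e\<in>F. ends I e = {(ws @ [w]) ! k, (ws @ [w]) ! Suc k}" if "Suc k < length (ws @ [w])" for k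
      using snoc.prems that unfolding is_path_def by blast
    have "is_path I F u ws (last ws)"
      unfolding is_path_def
    proof (intro conjI allI impI)
      show "\<exists>e\<in>F. ends I e = {ws ! k, ws ! Suc k}" if "Suc k < length ws" for k
        using edge[of k] that by (simp add: nth_append)
    qed (use snoc.prems False in \<open>auto simp: is_path_def\<close>)
    then have "(u, last ws) \<in> (adjacency I F)\<^sup>*"
      by (rule snoc.IH)
    moreover have "(last ws, w) \<in> adjacency I F"
      using edge[of "length ws - 1"] False by (auto simp: adjacency_def nth_append last_conv_nth)
    ultimately show ?thesis
      using snoc.prems by (auto simp: is_path_def)
  qed
qed

text \<open>The path is extended edge by edge; since \<open>is_path\<close> demands distinct
  vertices, a step back to a visited vertex cuts the path there instead of extending it. The
  assumption on \<open>ends\<close> keeps each new vertex inside \<open>verts I\<close>.\<close>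

lemma rtrancl_imp_is_path:
  assumes "(u, v) \<in> (adjacency I F)\<^sup>*" and "u \<in> verts I" and "\<And>e. e \<in> F \<Longrightarrow> ends I e \<subseteq> verts I"
  shows "\<exists>ws. is_path I F u ws v"
  using assms(1)
proof (induction rule: rtrancl_induct)
  case base
  have "is_path I F u [u] u"
    using assms(2) by (simp add: is_path_def)
  then show ?case ..
next
  case (step v w)
  then obtain ws where ws: "is_path I F u ws v" by blast
  from step obtain e where e: "e \<in> F" "ends I e = {v, w}"
    by (auto simp: adjacency_def)
  show ?case
  proof (cases "w \<in> set ws")
    case True
    then obtain k where k: "k < length ws" "ws ! k = w"
      by (auto simp: in_set_conv_nth)
    \<comment> \<open>The prefix ending at the earlier occurrence of \<open>w\<close> is the
      required path.\<close>
    then have "last (take (Suc k) ws) = w"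
      by (simp add: take_Suc_conv_app_nth)
    then have "is_path I F u (take (Suc k) ws) w"
      using ws k set_take_subset[of "Suc k" ws]
      by (auto simp: is_path_def)
    then show ?thesis ..
  next
    case False
    have "is_path I F u (ws @ [w]) w"
      unfolding is_path_def
    proof (intro conjI allI impI)
      fix k assume "Suc k < length (ws @ [w])"
      then consider "Suc k < length ws" | "Suc k = length ws" by force
      then show "\<exists>e\<in>F. ends I e = {(ws @ [w]) ! k, (ws @ [w]) ! Suc k}"
      proof cases
        case 1
        then show ?thesis using ws by (auto simp: is_path_def nth_append)
      next
        case 2
        moreover from 2 have "ws ! k = last ws" by (metis last_conv_nth diff_Suc_1 list.size(3) nat.distinct(1))
        ultimately have "(ws @ [w]) ! k = v" "(ws @ [w]) ! Suc k = w"
          using ws by (auto simp: is_path_def nth_append)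
        then show ?thesis using e by auto
      qed
    qed (use ws False e assms(3)[OF e(1)] in \<open>auto simp: is_path_def\<close>)
    then show ?thesis ..
  qed
qed

lemma joined_iff_rtrancl:
  assumes "wf_instance I" and "F \<subseteq> edges I"
  shows "joined I F \<longleftrightarrow> (splus I, sminus I) \<in> (adjacency I F)\<^sup>*"
  unfolding joined_def
  using is_path_imp_rtrancl rtrancl_imp_is_path[of "splus I" "sminus I" I F] assms
  by (metis subsetD wf_instance_def)

section \<open>Measure of the set of connected times\<close>

definition conn_set :: "('v, 'e) maint_instance \<Rightarrow> ('e \<Rightarrow> real) \<Rightarrow> real set" where
  "conn_set I a = {t. connected_at I a t}"

lemma open_conn_set:
  assumes "finite (edges I)"
  shows "open (conn_set I a)"
proof -
  let ?U = "\<lambda>F. \<Inter>e\<in>F. - {a e .. a e + real (ptime I e)}"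
  have "conn_set I a = \<Union> (?U ` {F. F \<subseteq> edges I \<and> joined I F})"
  proof (intro equalityI subsetI)
    fix t assume "t \<in> conn_set I a"
    then show "t \<in> \<Union> (?U ` {F. F \<subseteq> edges I \<and> joined I F})"
      by (auto simp: conn_set_def connected_at_joined available_def
          intro!: exI[of _ "available I a t"])
  next
    fix t assume "t \<in> \<Union> (?U ` {F. F \<subseteq> edges I \<and> joined I F})"
    then obtain F where "joined I F" "F \<subseteq> available I a t"
      unfolding available_def by blast
    then show "t \<in> conn_set I a"
      by (auto simp: conn_set_def connected_at_joined intro: joined_mono)
  qed
  moreover have "open (?U F)" if "F \<subseteq> edges I" for F
    using assms that by (intro open_INT ballI) (auto intro: finite_subset open_Compl)
  ultimately show ?thesis by auto
qed

text \<open>Half-open intervals make this exactly additive under concatenation.\<close>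

definition conn_between ::
    "('v, 'e) maint_instance \<Rightarrow> ('e \<Rightarrow> real) \<Rightarrow> real \<Rightarrow> real \<Rightarrow> real" where
  "conn_between I a l u = measure lborel ({l<..u} \<inter> conn_set I a)"

text \<open>Bounded intervals supply the finite measure that additivity and monotonicity of the
  real-valued \<open>measure\<close> require.\<close>

lemma conn_set_fmeasurable:
  assumes "finite (edges I)"
  shows "{l..u} \<inter> conn_set I a \<in> fmeasurable lborel" "{l<..u} \<inter> conn_set I a \<in> fmeasurable lborel"
proof -
  have "conn_set I a \<in> sets lborel"
    using open_conn_set[OF assms] by simp
  moreover have "{l..u} \<in> fmeasurable lborel"
    by (intro fmeasurableI) (auto simp: emeasure_lborel_Icc_eq)
  ultimately show "{l..u} \<inter> conn_set I a \<in> fmeasurable lborel" "{l<..u} \<inter> conn_set I a \<in> fmeasurable lborel"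
    by (auto intro: fmeasurableI2)
qed

lemma conn_time_alt: "conn_time I a = measure lborel ({0 .. real (horizon I)} \<inter> conn_set I a)"
  unfolding conn_time_def conn_set_def by (rule arg_cong[where f = "measure lborel"]) auto

lemma conn_time_eq_conn_between:
  assumes "finite (edges I)"
  shows "conn_time I a = conn_between I a 0 (real (horizon I))"
  unfolding conn_time_alt conn_between_def
proof (rule measure_eq_AE)
  \<comment> \<open>The closed and the half-open interval differ at 0 only, a null set.\<close>
  show "AE t in lborel. t \<in> {0..real (horizon I)} \<inter> conn_set I a \<longleftrightarrow> t \<in> {0<..real (horizon I)} \<inter> conn_set I a"
    using AE_lborel_singleton[of 0] by eventually_elim auto
qed (use conn_set_fmeasurable[OF assms, THEN fmeasurableD] in auto)

lemma conn_between_add: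
  assumes "finite (edges I)" and "l \<le> m" and "m \<le> u"
  shows "conn_between I a l u = conn_between I a l m + conn_between I a m u"
proof -
  have "{l<..u} \<inter> conn_set I a = ({l<..m} \<inter> conn_set I a) \<union> ({m<..u} \<inter> conn_set I a)"
    using assms by auto
  moreover have disjoint: "({l<..m} \<inter> conn_set I a) \<inter> ({m<..u} \<inter> conn_set I a) = {}"
    by auto
  ultimately show ?thesis
    unfolding conn_between_def
    using conn_set_fmeasurable(2)[OF assms(1), of _ _ a] by (simp add: measure_Un3 disjoint)
qed

text \<open>Constancy is asked for on the open interval only: the half-open interval omits
  \<open>l\<close>, and \<open>u\<close> is a null set. This is what makes the status at event times
  immaterial for the sweep.\<close>

lemma conn_between_const:
  assumes "finite (edges I)" and "l \<le> u"
    and "\<And>t. l < t \<Longrightarrow> t < u \<Longrightarrow> connected_at I a t \<longleftrightarrow> c"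
  shows "conn_between I a l u = (if c then u - l else 0)"
proof -
  have "conn_between I a l u = measure lborel (if c then {l<..u} else {})"
    unfolding conn_between_def
  proof (rule measure_eq_AE)
    show "AE t in lborel. t \<in> {l<..u} \<inter> conn_set I a \<longleftrightarrow> t \<in> (if c then {l<..u} else {})"
      using AE_lborel_singleton[of u]
    proof eventually_elim
      case (elim t)
      then show ?case using assms(3)[of t] by (auto simp: conn_set_def)
    qed
  qed (use conn_set_fmeasurable[OF assms(1), THEN fmeasurableD] in auto)
  then show ?thesis using assms(2) by (simp add: measure_def)
qed

section \<open>The approximation guarantee\<close>

lemma feasibleD:
  assumes "feasible I a" and "e \<in> edges I"
  shows "real (release I e) \<le> a e" "a e + real (ptime I e) \<le> real (deadline I e)"
  using assms unfolding feasible_def by (force simp: atLeastatMost_subset_iff)+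

lemma real_latest_start:
  assumes "wf_instance I" and "e \<in> edges I"
  shows "real (latest_start I e) = real (deadline I e) - real (ptime I e)"
  using assms by (auto simp: wf_instance_def latest_start_def of_nat_diff)

lemma feasible_cand:
  assumes "wf_instance I"
  shows "feasible I (cand I i)"
  unfolding feasible_def cand_def
  using assms real_latest_start[OF assms]
  by (auto simp: wf_instance_def latest_start_def of_nat_diff)

text \<open>Merges both branches of \<open>threshold\<close> into a lookup in one list, the same
  list that \<open>thresholdsC\<close> computes.\<close>

lemma threshold_eq_nth:
  assumes "i \<in> {1..num_latest I + 1}"
  shows "threshold I i = (sorted_list_of_set (latest_start I ` edges I) @ [horizon I]) ! (i - 1)"
  using assms by (auto simp: threshold_def nth_append num_latest_def)

lemma threshold_image:
  assumes "finite (edges I)"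
  shows "threshold I ` {1..num_latest I + 1} = insert (horizon I) (latest_start I ` edges I)"
proof -
  let ?L = "sorted_list_of_set (latest_start I ` edges I) @ [horizon I]"
  have "threshold I ` {1..num_latest I + 1} = (\<lambda>i. ?L ! (i - 1)) ` {1..num_latest I + 1}"
    by (rule image_cong) (simp_all only: threshold_eq_nth)
  also have "\<dots> = (!) ?L ` (\<lambda>i. i - 1) ` {1..num_latest I + 1}"
    by (simp add: image_image)
  \<comment> \<open>Indices counted from 1 become list positions counted from 0.\<close>
  also have "(\<lambda>i. i - 1) ` {1..num_latest I + 1} = {..<length ?L}"
    by (auto simp: num_latest_def image_iff intro!: bexI[of _ "Suc _"])
  also have "(!) ?L ` {..<length ?L} = set ?L"
    by (auto simp: set_conv_nth simp del: length_append set_append)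
  finally show ?thesis using assms by simp
qed

text \<open>An edge placed at its latest start begins no earlier than the threshold, hence after
  \<open>t\<close>. Any other edge satisfies \<open>a e \<le> latest_start I e < t\<close>, so
  availability under \<open>a\<close> means that it has finished, and a start at the release date
  finishes no later.\<close>

lemma available_cand:
  assumes "wf_instance I" and "feasible I a" and "t < real (threshold I i)"
    and "\<And>e. e \<in> edges I \<Longrightarrow> latest_start I e < threshold I i \<Longrightarrow> real (latest_start I e) < t"
  shows "available I a t \<subseteq> available I (cand I i) t"
proof
  fix e assume "e \<in> available I a t"
  then have e: "e \<in> edges I" "t \<notin> {a e .. a e + real (ptime I e)}"
    by (auto simp: available_def)
  have "t \<notin> {cand I i e .. cand I i e + real (ptime I e)}"
    using e assms(3) assms(4)[of e] feasibleD[OF assms(2) e(1)] real_latest_start[OF assms(1) e(1)]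
    by (auto simp: cand_def)
  with e show "e \<in> available I (cand I i) t"
    by (auto simp: available_def)
qed

lemma conn_set_subset_cand:
  assumes "wf_instance I" and "feasible I a"
  shows "{0..real (horizon I)} \<inter> conn_set I a - real ` insert (horizon I) (latest_start I ` edges I)
    \<subseteq> (\<Union>i\<in>{1..num_latest I + 1}. {0..real (horizon I)} \<inter> conn_set I (cand I i))"
proof
  let ?\<Theta> = "insert (horizon I) (latest_start I ` edges I)"
  have fin: "finite (edges I)" using assms(1) by (simp add: wf_instance_def)
  fix t assume "t \<in> {0..real (horizon I)} \<inter> conn_set I a - real ` ?\<Theta>"
  then have t: "0 \<le> t" "t \<le> real (horizon I)" "connected_at I a t" "t \<notin> real ` ?\<Theta>"
    by (auto simp: conn_set_def)
  define \<theta> where "\<theta> = Min {x \<in> ?\<Theta>. t < real x}"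
  \<comment> \<open>The horizon is a threshold above \<open>t\<close>, as \<open>t\<close> is at
    most the horizon and differs from it; so the minimum is over a nonempty set.\<close>
  have "horizon I \<in> {x \<in> ?\<Theta>. t < real x}" using t by auto
  then have \<theta>: "\<theta> \<in> ?\<Theta>" "t < real \<theta>" and Min: "\<And>x. x \<in> ?\<Theta> \<Longrightarrow> t < real x \<Longrightarrow> \<theta> \<le> x"
    using Min_in[of "{x \<in> ?\<Theta>. t < real x}"] fin unfolding \<theta>_def by auto
  obtain i where i: "i \<in> {1..num_latest I + 1}" "threshold I i = \<theta>"
    using \<theta>(1) threshold_image[OF fin] by (metis (no_types, lifting) imageE)
  have "available I a t \<subseteq> available I (cand I i) t"
  proof (rule available_cand[OF assms])
    fix e assume e: "e \<in> edges I" "latest_start I e < threshold I i"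
    \<comment> \<open>Minimality of the chosen threshold gives a latest start of at most
      \<open>t\<close>; equality is excluded because \<open>t\<close> is no threshold.\<close>
    then show "real (latest_start I e) < t"
      using Min[of "latest_start I e"] i t(4) by fastforce
  qed (use i \<theta> in simp)
  then have "connected_at I (cand I i) t"
    using t(3) by (auto simp: connected_at_joined intro: joined_mono)
  with i(1) t show "t \<in> (\<Union>i\<in>{1..num_latest I + 1}. {0..real (horizon I)} \<inter> conn_set I (cand I i))"
    by (auto simp: conn_set_def)
qed

text \<open>Deleting the finitely many threshold values leaves the measure unchanged; monotonicity
  and subadditivity of the measure do the rest.\<close>

lemma conn_time_le_sum_cand:
  assumes "wf_instance I" and "feasible I a"
  shows "conn_time I a \<le> (\<Sum>i\<in>{1..num_latest I + 1}. conn_time I (cand I i))"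
proof -
  let ?N = "real ` insert (horizon I) (latest_start I ` edges I)"
  let ?A = "{0..real (horizon I)} \<inter> conn_set I a"
  let ?B = "\<lambda>i. {0..real (horizon I)} \<inter> conn_set I (cand I i)"
  have fin: "finite (edges I)" using assms(1) by (simp add: wf_instance_def)
  have N: "?N \<in> null_sets lborel"
    using fin by (intro finite_imp_null_set_lborel) auto
  note meas = conn_set_fmeasurable(1)[OF fin]
  have "measure lborel ?A = measure lborel (?A - ?N)"
    by (rule measure_Diff_null_set[OF fmeasurableD[OF meas] N, symmetric])
  also have "\<dots> \<le> measure lborel (\<Union>i\<in>{1..num_latest I + 1}. ?B i)"
  proof (rule measure_mono_fmeasurable[OF conn_set_subset_cand[OF assms]])
    show "?A - ?N \<in> sets lborel"
      by (intro sets.Diff fmeasurableD[OF meas] null_setsD2[OF N])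
    show "(\<Union>i\<in>{1..num_latest I + 1}. ?B i) \<in> fmeasurable lborel"
      by (intro fmeasurable.finite_UN meas) auto
  qed
  also have "\<dots> \<le> (\<Sum>i\<in>{1..num_latest I + 1}. measure lborel (?B i))"
    by (intro measure_UNION_le fmeasurableD[OF meas]) auto
  finally show ?thesis by (simp only: conn_time_alt)
qed

lemma approx_solution_best_index:
  assumes "wf_instance I" and "best_index I i"
  shows "approx_solution (real (num_latest I + 1)) I (cand I i)"
proof -
  have le: "conn_time I a \<le> real (num_latest I + 1) * conn_time I (cand I i)" if "feasible I a" for a
  proof -
    have "conn_time I a \<le> (\<Sum>j\<in>{1..num_latest I + 1}. conn_time I (cand I j))"
      by (rule conn_time_le_sum_cand[OF assms(1) that])
    also have "\<dots> \<le> (\<Sum>j\<in>{1..num_latest I + 1}. conn_time I (cand I i))"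
      using assms(2) by (intro sum_mono) (auto simp: best_index_def)
    finally show ?thesis by simp
  qed
  \<comment> \<open>Bounding the supremum requires a feasible schedule to exist; a candidate is
    one.\<close>
  have "opt I \<le> real (num_latest I + 1) * conn_time I (cand I i)"
    unfolding opt_def using feasible_cand[OF assms(1)] le by (intro cSUP_least) auto
  then show ?thesis
    using feasible_cand[OF assms(1)] by (simp add: approx_solution_def divide_le_eq mult.commute)
qed

section \<open>Results of the costed computations\<close>

lemma fst_ret [simp]: "result (ret x) = x" and snd_ret [simp]: "steps (ret x) = 1"
  by (simp_all add: ret_def)

lemma fst_bind_costed [simp]: "result (bind_costed m f) = result (f (result m))"
  and snd_bind_costed [simp]: "steps (bind_costed m f) = steps m + steps (f (result m))"
  by (simp_all add: bind_costed_def)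

lemma result_prim [simp]:
  "result (addC m n) = m + n" "result (subC m n) = m - n" "result (lessC m n) \<longleftrightarrow> m < n"
  "result (veqC u v) \<longleftrightarrow> u = v"
  by (simp_all add: addC_def subC_def lessC_def veqC_def)

lemma result_mapC [simp]: "result (mapC f xs) = map (\<lambda>x. result (f x)) xs"
  by (induction xs) auto

lemma result_filterC [simp]: "result (filterC P xs) = filter (\<lambda>x. result (P x)) xs"
  by (induction xs) auto

lemma result_foldC [simp]: "result (foldC f xs s) = fold (\<lambda>x s. result (f x s)) xs s"
  by (induction xs arbitrary: s) auto

lemma result_snocC [simp]: "result (snocC xs y) = xs @ [y]"
  by (induction xs) auto

lemma result_memC [simp]: "result (memC v ws) \<longleftrightarrow> v \<in> set ws"
  by (induction ws) auto

section \<open>Sorted lists of events and thresholds\<close>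

lemma set_insertC [simp]: "set (result (insertC x ys)) = insert x (set ys)"
  by (induction ys) auto

lemma sorted_insertC: "sorted_wrt (<) ys \<Longrightarrow> sorted_wrt (<) (result (insertC x ys))"
  by (induction ys) auto

lemma result_latestC [simp]: "result (latestC j) = jdead j - jproc j"
  by (simp add: latestC_def)

lemma fold_insertC:
  assumes "sorted_wrt (<) ys"
  shows "sorted_wrt (<) (fold (\<lambda>x ys. result (insertC (f x) ys)) xs ys) \<and>
    set (fold (\<lambda>x ys. result (insertC (f x) ys)) xs ys) = set ys \<union> f ` set xs"
  using assms by (induction xs arbitrary: ys) (auto simp: sorted_insertC)

text \<open>Each job inserts two events, its start and its finish, so the induction behind
  \<open>fold_insertC\<close> is carried out anew for the double insertion.\<close>

lemma result_eventsC:
  "sorted_wrt (<) (result (eventsC S T))"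
  "set (result (eventsC S T)) =
     {0, T} \<union> snd ` set S \<union> (\<lambda>js. snd js + jproc (fst js)) ` set S"
proof -
  let ?ins = "\<lambda>js ev. result (insertC (snd js + jproc (fst js)) (result (insertC (snd js) ev)))"
  have "sorted_wrt (<) (fold ?ins S ev) \<and>
      set (fold ?ins S ev) = set ev \<union> snd ` set S \<union> (\<lambda>js. snd js + jproc (fst js)) ` set S"
    if "sorted_wrt (<) ev" for ev
    using that by (induction S arbitrary: ev) (auto simp: sorted_insertC)
  from this[OF sorted_insertC[of "[0]" T]]
  show "sorted_wrt (<) (result (eventsC S T))"
    "set (result (eventsC S T)) =
     {0, T} \<union> snd ` set S \<union> (\<lambda>js. snd js + jproc (fst js)) ` set S"
    by (auto simp: eventsC_def)
qed

text \<open>A strictly increasing list is determined by its set, so \<open>fold_insertC\<close>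
  identifies the computed list.\<close>

lemma result_thresholdsC:
  "result (thresholdsC js T) =
     sorted_list_of_set ((\<lambda>j. jdead j - jproc j) ` set js) @ [T]"
  using fold_insertC[of "[]" "\<lambda>j. jdead j - jproc j" js]
  by (auto simp: thresholdsC_def strict_sorted_iff
      dest!: sorted_list_of_set.idem_if_sorted_distinct[symmetric])

text \<open>The fold starts at 0, which also gives the default horizon of an instance without
  edges.\<close>

lemma result_horizonC: "result (horizonC js) = Max (insert 0 (jdead ` set js))"
proof -
  have "result (horizonC js) = fold max (map jdead js) 0"
  proof -
    have "(if m < n then n else m) = max n m" for m n :: nat
      by simp
    then show ?thesis by (simp add: horizonC_def fold_map o_def)
  qed
  also have "\<dots> = Max (insert 0 (jdead ` set js))"
    by (metis Max.set_eq_fold list.set(2) set_map)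
  finally show ?thesis .
qed

subsection \<open>Reachability\<close>

text \<open>The body of the loop in \<open>roundC\<close> without its cost. An edge may be crossed
  in either direction, and the guards keep the list free of duplicates.\<close>

definition round_step :: "('v, 'e) job \<Rightarrow> 'v list \<Rightarrow> 'v list" where
  "round_step j R =
     (if jend1 j \<in> set R \<and> jend2 j \<notin> set R then jend2 j # R
      else if jend2 j \<in> set R \<and> jend1 j \<notin> set R then jend1 j # R else R)"

lemma result_roundC: "result (roundC js R) = fold round_step js R"
  unfolding roundC_def round_step_def by (simp cong del: if_weak_cong)

lemma result_reachC:
  "result (reachC x js) \<longleftrightarrow> target x \<in> set ((fold round_step js ^^ length (vlist x)) [source x])"
proof -
  have "fold (\<lambda>_. g) xs s = (g ^^ length xs) s" for g :: "'a list \<Rightarrow> 'a list" and xs :: "'a list" and s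
    by (induction xs arbitrary: s) (auto simp: funpow_swap1)
  then show ?thesis by (simp add: reachC_def result_roundC)
qed

text \<open>No step shortens the list, and a step that changes it adds a vertex. A round without
  growth therefore changed nothing at any job, which means that no edge leaves the reached
  set.\<close>

lemma fold_round_step_cases:
  "fold round_step js R = R \<and> (\<forall>j\<in>set js. jend1 j \<in> set R \<longleftrightarrow> jend2 j \<in> set R) \<or>
   length R < length (fold round_step js R)"
proof (induction js arbitrary: R)
  case (Cons j js)
  show ?case
  proof (cases "round_step j R = R")
    case True
    then have "jend1 j \<in> set R \<longleftrightarrow> jend2 j \<in> set R"
      by (auto simp: round_step_def split: if_splits)
    then show ?thesis using Cons[of R] True by auto
  next
    case False
    then have "length R < length (round_step j R)"
      by (auto simp: round_step_def split: if_splits)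
    moreover have "length (round_step j R) \<le> length (fold round_step js (round_step j R))"
      using Cons[of "round_step j R"] by (metis order.refl less_imp_le)
    ultimately show ?thesis by simp
  qed
qed simp

lemma fold_round_step_distinct: "distinct R \<Longrightarrow> distinct (fold round_step js R)"
  by (induction js arbitrary: R) (auto simp: round_step_def)

lemma fold_round_step_superset: "set R \<subseteq> set (fold round_step js R)"
proof (induction js arbitrary: R)
  case (Cons j js)
  have "set R \<subseteq> set (round_step j R)" by (auto simp: round_step_def)
  with Cons[of "round_step j R"] show ?case by simp
qed simp

text \<open>Used with \<open>C\<close> the vertex set, to bound the length of the list, and with
  \<open>C\<close> the reachable set, to show that only reachable vertices are added.\<close>

lemma fold_round_step_subset:
  assumes "\<And>j. j \<in> set js \<Longrightarrow> jend1 j \<in> C \<longleftrightarrow> jend2 j \<in> C" and "set R \<subseteq> C"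
  shows "set (fold round_step js R) \<subseteq> C"
  using assms
proof (induction js arbitrary: R)
  case (Cons j js)
  have "set (round_step j R) \<subseteq> C"
    using Cons.prems(1)[of j] Cons.prems(2) by (auto simp: round_step_def)
  then show ?case
    using Cons.IH[of "round_step j R"] Cons.prems(1) by simp
qed simp

text \<open>A round that is not yet closed adds a vertex, so as many rounds as there are vertices suffice.\<close>

lemma set_funpow_round_step:
  assumes "finite V" and "card V \<le> n" and "s \<in> V"
    and "\<And>j. j \<in> set js \<Longrightarrow> jend1 j \<in> V \<and> jend2 j \<in> V"
  shows "set ((fold round_step js ^^ n) [s]) =
    {(u, v). \<exists>j\<in>set js. {jend1 j, jend2 j} = {u, v}}\<^sup>* `` {s}" (is "set ?R = ?E\<^sup>* `` {s}")
proof
  let ?g = "fold round_step js"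
  have "distinct ((?g ^^ k) [s])" for k
    by (induction k) (simp_all add: fold_round_step_distinct)
  moreover have "set ((?g ^^ k) [s]) \<subseteq> V" for k
    using assms(3,4) by (induction k) (simp_all add: fold_round_step_subset)
  ultimately have bound: "length ((?g ^^ k) [s]) \<le> n" for k
    using card_mono[OF assms(1)] assms(2) by (metis distinct_card order.trans)
  \<comment> \<open>Every round before stabilization adds at least one vertex to the initial one. At
    \<open>k = n\<close> the second alternative contradicts \<open>bound\<close>, which leaves a
    fixed point.\<close>
  have "?g ((?g ^^ k) [s]) = (?g ^^ k) [s] \<or> k < length ((?g ^^ k) [s])" for k
  proof (induction k)
    case (Suc k)
    then show ?case using fold_round_step_cases[of js "(?g ^^ k) [s]"] by auto
  qed simp
  then have "?g ?R = ?R"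
    using bound[of n] by (meson leD)
  then have closed: "\<forall>j\<in>set js. jend1 j \<in> set ?R \<longleftrightarrow> jend2 j \<in> set ?R"
    using fold_round_step_cases[of js ?R] by auto
  have "set [s] \<subseteq> set ((?g ^^ k) [s])" for k
    by (induction k) (simp_all add: fold_round_step_superset[THEN subsetD])
  then have base: "s \<in> set ?R" by simp
  have step: "v \<in> set ?R" if "u \<in> set ?R" "(u, v) \<in> ?E" for u v
    using that closed by (auto simp: doubleton_eq_iff)
  have "v \<in> set ?R" if "(s, v) \<in> ?E\<^sup>*" for v
    using that by (induction rule: rtrancl_induct) (fact base, rule step)
  then show "?E\<^sup>* `` {s} \<subseteq> set ?R" by blast
  have "jend1 j \<in> ?E\<^sup>* `` {s} \<longleftrightarrow> jend2 j \<in> ?E\<^sup>* `` {s}" if "j \<in> set js" for j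
  proof -
    have "(jend1 j, jend2 j) \<in> ?E" "(jend2 j, jend1 j) \<in> ?E"
      using that by (auto intro!: bexI[of _ j])
    then show ?thesis by (auto intro: rtrancl_into_rtrancl)
  qed
  then show "set ?R \<subseteq> ?E\<^sup>* `` {s}"
    by (induction n) (simp_all add: fold_round_step_subset)
qed

text \<open>The running best is always \<open>f\<close> of some argument, so the induction replaces
  the first two arguments by the winner of their comparison.\<close>

lemma fold_better:
  fixes f :: "'a \<Rightarrow> 'b \<times> nat"
  shows "\<exists>y\<in>set (x # xs). fold (\<lambda>t b. if snd b < snd (f t) then f t else b) xs (f x) = f y \<and>
    (\<forall>z\<in>set (x # xs). snd (f z) \<le> snd (f y))"
proof (induction xs arbitrary: x)
  case (Cons z zs)
  from Cons[of "if snd (f x) < snd (f z) then z else x"] show ?case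
    by (auto split: if_splits)
qed simp

subsection \<open>The algorithm on an encoded instance\<close>

locale encoded_instance =
  fixes x :: "('v, 'e) input" and I :: "('v, 'e) maint_instance"
  assumes wf: "wf_instance I" and enc: "encodes x I"
begin

lemma finite_edges: "finite (edges I)"
  using wf by (simp add: wf_instance_def)

lemma edges_eq: "edges I = jid ` set (jobs x)"
  using enc by (simp add: encodes_def)

lemma distinct_jid: "distinct (map jid (jobs x))"
  using enc by (simp add: encodes_def)

lemma jobD:
  assumes "j \<in> set (jobs x)"
  shows "ends I (jid j) = {jend1 j, jend2 j}" "jend1 j \<in> verts I" "jend2 j \<in> verts I"
    "ptime I (jid j) = jproc j" "release I (jid j) = jrel j" "deadline I (jid j) = jdead j"
    "latest_start I (jid j) = jdead j - jproc j" "jrel j + jproc j \<le> jdead j"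
proof -
  show eqs: "ends I (jid j) = {jend1 j, jend2 j}" "ptime I (jid j) = jproc j"
    "release I (jid j) = jrel j" "deadline I (jid j) = jdead j"
    using enc assms by (auto simp: encodes_def)
  have "jid j \<in> edges I" using assms edges_eq by simp
  then show "jend1 j \<in> verts I" "jend2 j \<in> verts I" "jrel j + jproc j \<le> jdead j"
    using wf eqs by (auto simp: wf_instance_def dest!: bspec)
  show "latest_start I (jid j) = jdead j - jproc j"
    by (simp add: latest_start_def eqs)
qed

lemma latest_starts: "latest_start I ` edges I = (\<lambda>j. jdead j - jproc j) ` set (jobs x)"
  using jobD by (auto simp: edges_eq image_image)

lemma result_horizonC_jobs: "result (horizonC (jobs x)) = horizon I"
proof -
  have "jdead ` set (jobs x) = deadline I ` edges I"
    using jobD(6) by (simp add: edges_eq image_image)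
  then show ?thesis
    using finite_edges by (cases "edges I = {}") (simp_all add: result_horizonC horizon_def)
qed

text \<open>\<open>vlist x\<close> enumerates \<open>verts I\<close> without repetition, so
  \<open>reachC\<close> runs exactly as many rounds as there are vertices, enough for
  \<open>set_funpow_round_step\<close>.\<close>

lemma result_reachC_joined:
  assumes "set js \<subseteq> set (jobs x)"
  shows "result (reachC x js) \<longleftrightarrow> joined I (jid ` set js)"
proof -
  have "{(u, v). \<exists>j\<in>set js. {jend1 j, jend2 j} = {u, v}} = adjacency I (jid ` set js)"
    unfolding adjacency_def using jobD(1) assms by (auto simp: subset_iff)
  moreover have "set ((fold round_step js ^^ length (vlist x)) [source x]) =
      {(u, v). \<exists>j\<in>set js. {jend1 j, jend2 j} = {u, v}}\<^sup>* `` {source x}"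
    using wf enc jobD(2,3) assms
    by (intro set_funpow_round_step[of "verts I"])
       (auto simp: wf_instance_def encodes_def distinct_card dest: sym)
  moreover have "jid ` set js \<subseteq> edges I"
    unfolding edges_eq using assms by (rule image_mono)
  moreover have "source x = splus I" "target x = sminus I"
    using enc by (simp_all add: encodes_def)
  ultimately show ?thesis
    by (simp add: result_reachC joined_iff_rtrancl[OF wf])
qed

section \<open>Exactness of the sweep over event times\<close>

text \<open>Start times are given by a function \<open>\<sigma>\<close> on jobs because every list
  produced by \<open>candC\<close> has this shape. The half-open test regards a job of length zero
  as always free.\<close>

lemma result_connectedC:
  "result (connectedC x (map (\<lambda>j. (j, \<sigma> j)) (jobs x)) a) \<longleftrightarrow>
     joined I (jid ` {j \<in> set (jobs x). a < \<sigma> j \<or> \<sigma> j + jproc j \<le> a})"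
proof -
  let ?js = "filter (\<lambda>j. a < \<sigma> j \<or> \<sigma> j + jproc j \<le> a) (jobs x)"
  have "result (connectedC x (map (\<lambda>j. (j, \<sigma> j)) (jobs x)) a) = result (reachC x ?js)"
    by (simp add: connectedC_def freeC_def filter_map o_def not_less)
  also have "\<dots> \<longleftrightarrow> joined I (jid ` set ?js)"
    by (rule result_reachC_joined) auto
  finally show ?thesis by simp
qed

text \<open>With no start or finish strictly between \<open>a\<close> and \<open>b\<close>, the
  closed-interval test at an inner time \<open>t\<close> agrees with the half-open test at
  \<open>a\<close> for each job.\<close>

lemma connected_at_between_events:
  assumes "\<And>j. j \<in> set (jobs x) \<Longrightarrow> sch (jid j) = real (\<sigma> j)"
    and "\<And>j. j \<in> set (jobs x) \<Longrightarrow> \<sigma> j \<le> a \<or> b \<le> \<sigma> j"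
    and "\<And>j. j \<in> set (jobs x) \<Longrightarrow> \<sigma> j + jproc j \<le> a \<or> b \<le> \<sigma> j + jproc j"
    and "real a < t" and "t < real b"
  shows "connected_at I sch t \<longleftrightarrow> result (connectedC x (map (\<lambda>j. (j, \<sigma> j)) (jobs x)) a)"
proof -
  have "t \<notin> {sch (jid j) .. sch (jid j) + real (ptime I (jid j))} \<longleftrightarrow> a < \<sigma> j \<or> \<sigma> j + jproc j \<le> a"
    if "j \<in> set (jobs x)" for j
    using assms(1-3)[OF that] assms(4,5) jobD(4)[OF that] by auto
  then have "available I sch t = jid ` {j \<in> set (jobs x). a < \<sigma> j \<or> \<sigma> j + jproc j \<le> a}"
    unfolding available_def edges_eq by blast
  then show ?thesis by (simp add: connected_at_joined result_connectedC)
qed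

text \<open>The alternative of lying at or before \<open>hd ev\<close> keeps the hypotheses
  inductive: events dropped from the list are in the past of the remaining sweep.\<close>

lemma result_sweepC:
  assumes "\<And>j. j \<in> set (jobs x) \<Longrightarrow> sch (jid j) = real (\<sigma> j)"
    and "ev \<noteq> []" and "sorted_wrt (<) ev"
    and "\<And>j. j \<in> set (jobs x) \<Longrightarrow> \<sigma> j \<in> set ev \<or> \<sigma> j \<le> hd ev"
    and "\<And>j. j \<in> set (jobs x) \<Longrightarrow> \<sigma> j + jproc j \<in> set ev \<or> \<sigma> j + jproc j \<le> hd ev"
  shows "real (result (sweepC x (map (\<lambda>j. (j, \<sigma> j)) (jobs x)) ev)) =
    conn_between I sch (real (hd ev)) (real (last ev))"
  using assms(2-)
proof (induction ev rule: induct_list012)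
  case (2 a)
  then show ?case by (simp add: conn_between_def)
next
  case (3 a b ev)
  let ?S = "map (\<lambda>j. (j, \<sigma> j)) (jobs x)"
  have "b \<le> last (b # ev)" "a < b"
    using 3(4) by (auto simp: less_imp_le)
  \<comment> \<open>Consecutive list entries have no event strictly between them.\<close>
  have a: "p \<le> a \<or> b \<le> p" if "p \<in> set (a # b # ev) \<or> p \<le> hd (a # b # ev)" for p
    using that 3(4) by auto
  have "conn_between I sch (real a) (real b) = (if result (connectedC x ?S a) then real b - real a else 0)"
    using \<open>a < b\<close> connected_at_between_events[OF assms(1) a[OF 3(5)] a[OF 3(6)]]
    by (intro conn_between_const finite_edges) auto
  moreover have "real (result (sweepC x ?S (b # ev))) = conn_between I sch (real b) (real (last (b # ev)))"
  proof -
    have "p \<in> set (b # ev) \<or> p \<le> hd (b # ev)" if "p \<in> set (a # b # ev) \<or> p \<le> hd (a # b # ev)" for p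
      using that \<open>a < b\<close> by auto
    from 3(2)[OF _ _ this[OF 3(5)] this[OF 3(6)]] 3(4) show ?thesis by simp
  qed
  moreover have "conn_between I sch (real a) (real (last (b # ev))) =
      conn_between I sch (real a) (real b) + conn_between I sch (real b) (real (last (b # ev)))"
    using \<open>a < b\<close> \<open>b \<le> last (b # ev)\<close> by (intro conn_between_add finite_edges) auto
  ultimately show ?case using \<open>a < b\<close> by (simp add: of_nat_diff)
qed simp

lemma jdead_le_horizon: "j \<in> set (jobs x) \<Longrightarrow> jdead j \<le> horizon I"
  unfolding result_horizonC_jobs[symmetric] result_horizonC by (intro Max_ge) auto

text \<open>Deadlines bound all finishing times, so the event list runs from 0 to exactly the
  horizon and the sweep accounts for all of \<open>conn_time\<close>.\<close>

lemma result_conn_timeC: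
  assumes "\<And>j. j \<in> set (jobs x) \<Longrightarrow> sch (jid j) = real (\<sigma> j)"
    and "\<And>j. j \<in> set (jobs x) \<Longrightarrow> \<sigma> j + jproc j \<le> jdead j"
  shows "real (result (conn_timeC x (horizon I) (map (\<lambda>j. (j, \<sigma> j)) (jobs x)))) = conn_time I sch"
proof -
  let ?S = "map (\<lambda>j. (j, \<sigma> j)) (jobs x)"
  define ev where "ev = result (eventsC ?S (horizon I))"
  have sorted: "sorted_wrt (<) ev" and set: "set ev = {0, horizon I} \<union> \<sigma> ` set (jobs x) \<union>
      (\<lambda>j. \<sigma> j + jproc j) ` set (jobs x)"
    using result_eventsC[of ?S "horizon I"] unfolding ev_def by (simp_all add: image_image)
  have le: "p \<le> horizon I" if "p \<in> set ev" for p
    using that jdead_le_horizon assms(2) unfolding set by fastforce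
  have "ev \<noteq> []" using set by auto
  have mem: "0 \<in> set ev" "horizon I \<in> set ev" by (simp_all add: set)
  have "hd ev = 0"
    using sorted mem(1) by (cases ev) auto
  have "horizon I \<le> last ev"
    using sorted mem(2) by (cases ev rule: rev_cases) (auto simp: sorted_wrt_append less_imp_le)
  then have "last ev = horizon I"
    using le[of "last ev"] \<open>ev \<noteq> []\<close> by simp
  have "real (result (sweepC x ?S ev)) = conn_between I sch (real (hd ev)) (real (last ev))"
    using set by (intro result_sweepC assms(1) \<open>ev \<noteq> []\<close> sorted) auto
  then show ?thesis
    by (simp add: conn_timeC_def ev_def[symmetric] \<open>hd ev = 0\<close> \<open>last ev = horizon I\<close>
        conn_time_eq_conn_between finite_edges)
qed

section \<open>Selection of the best candidate\<close>

definition cand_start :: "nat \<Rightarrow> ('v, 'e) job \<Rightarrow> nat" where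
  "cand_start t j = (if jdead j - jproc j < t then jrel j else jdead j - jproc j)"

lemma result_candC: "result (candC (jobs x) t) = map (\<lambda>j. (j, cand_start t j)) (jobs x)"
  by (simp add: candC_def cand_start_def)

lemma cand_start_le: "j \<in> set (jobs x) \<Longrightarrow> cand_start t j + jproc j \<le> jdead j"
  using jobD(8)[of j] by (auto simp: cand_start_def)

lemma cand_eq_cand_start: "j \<in> set (jobs x) \<Longrightarrow> cand I i (jid j) = real (cand_start (threshold I i) j)"
  by (simp add: cand_def cand_start_def jobD)

text \<open>A plain function of the threshold, the form in which \<open>fold_better\<close> applies
  to the selection loop.\<close>

definition evaluation :: "nat \<Rightarrow> (('v, 'e) job \<times> nat) list \<times> nat" where
  "evaluation t = result (evaluateC x (horizon I) t)"

lemma evaluation_cand: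
  "fst (evaluation (threshold I i)) = map (\<lambda>j. (j, cand_start (threshold I i) j)) (jobs x)"
  "real (snd (evaluation (threshold I i))) = conn_time I (cand I i)"
  using result_conn_timeC[of "cand I i" "cand_start (threshold I i)", OF cand_eq_cand_start cand_start_le]
  by (simp_all add: evaluation_def evaluateC_def result_candC)

text \<open>The selection takes a maximum, for which it suffices to know the set of
  thresholds.\<close>

lemma set_thresholds:
  "set (result (thresholdsC (jobs x) (horizon I))) = threshold I ` {1..num_latest I + 1}"
  unfolding threshold_image[OF finite_edges]
  by (simp add: result_thresholdsC finite_edges flip: latest_starts)

lemma result_best_candidate:
  "\<exists>i. best_index I i \<and> result (best_candidate x) =
     map (\<lambda>j. (jid j, cand_start (threshold I i) j)) (jobs x)"
proof -
  define ts where "ts = result (thresholdsC (jobs x) (horizon I))"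
  \<comment> \<open>The list ends in the horizon, so it is nonempty even for an instance without
    edges.\<close>
  have ts: "hd ts # tl ts = ts"
    by (simp add: ts_def result_thresholdsC)
  obtain t where t: "t \<in> set ts"
      "fold (\<lambda>t b. if snd b < snd (evaluation t) then evaluation t else b) (tl ts) (evaluation (hd ts)) =
        evaluation t"
      "\<forall>t'\<in>set ts. snd (evaluation t') \<le> snd (evaluation t)"
    using fold_better[of "hd ts" "tl ts" evaluation] unfolding ts by blast
  have set_ts: "set ts = threshold I ` {1..num_latest I + 1}"
    unfolding ts_def by (rule set_thresholds)
  then obtain i where i: "i \<in> {1..num_latest I + 1}" "t = threshold I i"
    using t(1) by blast
  \<comment> \<open>The computed values are exact, so comparing them compares connectivity
    times.\<close>
  have "conn_time I (cand I k) \<le> conn_time I (cand I i)" if "k \<in> {1..num_latest I + 1}" for k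
    using t(3) that unfolding set_ts i(2) evaluation_cand(2)[symmetric] by simp
  then have "best_index I i"
    using i(1) by (simp add: best_index_def)
  moreover have "result (best_candidate x) = map (\<lambda>js. (jid (fst js), snd js)) (fst (evaluation t))"
    using t(2) by (simp add: best_candidate_def result_horizonC_jobs flip: ts_def evaluation_def cong del: if_weak_cong)
  ultimately show ?thesis
    using evaluation_cand(1)[of i] i(2) by (auto simp: o_def)
qed

text \<open>Distinct job names make \<open>map_of\<close> return the entry of the intended
  job.\<close>

lemma schedule_of_best_candidate:
  "\<exists>i. best_index I i \<and> (\<forall>e\<in>edges I. schedule_of (result (best_candidate x)) e = cand I i e)"
proof -
  obtain i where i: "best_index I i" "result (best_candidate x) =
     map (\<lambda>j. (jid j, cand_start (threshold I i) j)) (jobs x)"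
    using result_best_candidate by blast
  have "schedule_of (result (best_candidate x)) (jid j) = cand I i (jid j)" if "j \<in> set (jobs x)" for j
  proof -
    have "map_of (result (best_candidate x)) (jid j) = Some (cand_start (threshold I i) j)"
      unfolding i(2) using that distinct_jid by (intro map_of_is_SomeI) (auto simp: o_def)
    then show ?thesis using that by (simp add: schedule_of_def cand_eq_cand_start)
  qed
  with i(1) show ?thesis by (auto simp: edges_eq)
qed

lemma fst_best_candidate: "map fst (result (best_candidate x)) = map jid (jobs x)"
  using result_best_candidate by (auto simp: o_def)

end

text \<open>Needed because the output list determines start times on edges only.\<close>

lemma approx_solution_cong:
  assumes "\<forall>e\<in>edges I. a e = b e"
  shows "approx_solution \<alpha> I a \<longleftrightarrow> approx_solution \<alpha> I b"
proof -
  have "available I a = available I b"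
    using assms by (auto simp: available_def fun_eq_iff)
  then show ?thesis
    using assms by (simp add: approx_solution_def conn_time_def connected_at_def feasible_def)
qed

section \<open>Running time\<close>

lemma steps_mapC_le:
  assumes "length xs \<le> n" and "\<And>x. x \<in> set xs \<Longrightarrow> steps (f x) \<le> c"
  shows "steps (mapC f xs) \<le> n * (c + 1) + 1"
proof -
  have "steps (mapC f xs) \<le> length xs * (c + 1) + 1"
    using assms(2)
  proof (induction xs)
    case (Cons x xs)
    then have "steps (f x) \<le> c" "steps (mapC f xs) \<le> length xs * (c + 1) + 1" by auto
    then show ?case by simp
  qed simp
  also have "\<dots> \<le> n * (c + 1) + 1"
    using assms(1) by (intro add_mono mult_le_mono) auto
  finally show ?thesis .
qed

lemma steps_filterC_le:
  assumes "length xs \<le> n" and "\<And>x. x \<in> set xs \<Longrightarrow> steps (P x) \<le> c"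
  shows "steps (filterC P xs) \<le> n * (c + 1) + 1"
proof -
  have "steps (filterC P xs) \<le> length xs * (c + 1) + 1"
    using assms(2)
  proof (induction xs)
    case (Cons x xs)
    then have "steps (P x) \<le> c" "steps (filterC P xs) \<le> length xs * (c + 1) + 1" by auto
    then show ?case by simp
  qed simp
  also have "\<dots> \<le> n * (c + 1) + 1"
    using assms(1) by (intro add_mono mult_le_mono) auto
  finally show ?thesis .
qed

text \<open>Result and cost are treated together because the cost of a step depends on the size of
  the state, which the invariant \<open>P\<close> controls.\<close>

lemma foldC_invariant:
  assumes "length xs \<le> n" and "P s"
    and step: "\<And>x s. x \<in> set xs \<Longrightarrow> P s \<Longrightarrow> P (result (f x s)) \<and> steps (f x s) \<le> c"
  shows "P (result (foldC f xs s)) \<and> steps (foldC f xs s) \<le> n * c + 1"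
proof -
  have "P (result (foldC f xs s)) \<and> steps (foldC f xs s) \<le> length xs * c + 1"
    using assms(2) step
  proof (induction xs arbitrary: s)
    case (Cons x xs)
    then have "P (result (f x s))" "steps (f x s) \<le> c" by simp_all
    moreover from this(1) have "P (result (foldC f xs (result (f x s)))) \<and>
        steps (foldC f xs (result (f x s))) \<le> length xs * c + 1"
      by (rule Cons.IH) (simp add: Cons.prems(2))
    ultimately show ?case by (simp del: result_foldC)
  qed simp
  moreover have "length xs * c + 1 \<le> n * c + 1"
    using assms(1) by simp
  ultimately show ?thesis by linarith
qed

lemma steps_snocC [simp]: "steps (snocC xs y) = length xs + 1"
  by (induction xs) auto

lemma steps_memC_le: "steps (memC v ws) \<le> length ws + 1"
  by (induction ws) (auto simp: veqC_def)

text \<open>Each element visited costs two comparisons of at most \<open>2 * b + 1\<close> and one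
  \<open>ret\<close>; the additional factor unit pays for reaching the end.\<close>

lemma steps_insertC_le:
  assumes "bits x \<le> b" and "\<And>y. y \<in> set ys \<Longrightarrow> bits y \<le> b" and "length ys \<le> n"
  shows "steps (insertC x ys) \<le> (n + 1) * (4 * b + 3)"
proof -
  have "steps (insertC x ys) \<le> (length ys + 1) * (4 * b + 3)"
    using assms(1,2)
  proof (induction ys)
    case (Cons y ys)
    then have "bits y \<le> b" "steps (insertC x ys) \<le> (length ys + 1) * (4 * b + 3)" by auto
    with Cons.prems(1) show ?case
      by (simp add: lessC_def algebra_simps)
  qed simp
  also have "\<dots> \<le> (n + 1) * (4 * b + 3)"
    using assms(3) by (intro mult_le_mono) auto
  finally show ?thesis .
qed

lemma length_le_card:
  assumes "distinct xs" and "set xs \<subseteq> A" and "finite A"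
  shows "length xs \<le> card A"
  using assms by (metis card_mono distinct_card)

text \<open>The lengths of all intervals telescope, whichever of them are counted. This bounds the
  operands of the additions in the sweep.\<close>

lemma sweepC_le:
  assumes "sorted_wrt (<) ev" and "ev \<noteq> []"
  shows "result (sweepC x S ev) \<le> last ev - hd ev"
  using assms
proof (induction ev rule: induct_list012)
  case (3 a b ev)
  then have "result (sweepC x S (b # ev)) \<le> last (b # ev) - b" "a < b" "b \<le> last (b # ev)"
    by (auto simp: less_imp_le)
  then show ?case by auto
qed simp_all

text \<open>
  The bounds are polymorphic: on natural numbers they bound step counts in terms of the input size,
  and on the polynomial \<open>[:0, 1:]\<close> they are the polynomials that witness this.
\<close>

definition reach_bound :: "'a::comm_semiring_1 \<Rightarrow> 'a" where
  "reach_bound n = n * (n * (2 * n + 3) + 1) + n + 2"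

definition connected_bound :: "'a::comm_semiring_1 \<Rightarrow> 'a" where
  "connected_bound n = n * (6 * n + 5) + 1 + (n * 2 + 1) + reach_bound n"

definition events_bound :: "'a::comm_semiring_1 \<Rightarrow> 'a" where
  "events_bound n = 2 * (4 * n + 3) + (n * (2 * n + 1 + 2 * ((2 * n + 3) * (4 * n + 3))) + 1)"

definition evaluate_bound :: "'a::comm_semiring_1 \<Rightarrow> 'a" where
  "evaluate_bound n = n * (4 * n + 4) + 1 +
     (events_bound n + ((2 * n + 2) * (connected_bound n + 4 * n + 2) + 1)) + 1"

definition thresholds_bound :: "'a::comm_semiring_1 \<Rightarrow> 'a" where
  "thresholds_bound n = n * (2 * n + 1 + (n + 1) * (4 * n + 3)) + 1 + (n + 1)"

definition best_bound :: "'a::comm_semiring_1 \<Rightarrow> 'a" where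
  "best_bound n = n * (2 * n + 2) + 1 + thresholds_bound n + evaluate_bound n +
     (n * (evaluate_bound n + 2 * n + 2) + 1) + (n * 2 + 1)"

text \<open>Evaluation is a semiring homomorphism, and the bounds are built from semiring operations
  only.\<close>

lemma poly_best_bound: "poly (best_bound p) n = best_bound (poly p n)"
  by (simp add: best_bound_def thresholds_bound_def evaluate_bound_def events_bound_def
      connected_bound_def reach_bound_def)

context encoded_instance
begin

section \<open>Sizes of numbers and lists against the input size\<close>

lemma length_vlist: "length (vlist x) = card (verts I)"
  using enc distinct_card[of "vlist x"] by (simp add: encodes_def)

lemma length_vlist_le: "length (vlist x) \<le> input_size x"
  by (simp add: input_size_def)

lemma length_jobs_le: "length (jobs x) \<le> input_size x"
proof -
  have "length js \<le> (\<Sum>j\<leftarrow>js. 1 + bits (jproc j) + bits (jrel j) + bits (jdead j))"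
    for js :: "('v, 'e) job list"
    by (induction js) auto
  from this[of "jobs x"] show ?thesis by (simp add: input_size_def)
qed

text \<open>The horizon is 0 or one of the deadlines, and each deadline contributes its binary
  length to \<open>input_size\<close>. All operands are later shown to be at most the
  horizon.\<close>

lemma bits_le:
  assumes "k \<le> horizon I"
  shows "bits k \<le> input_size x"
proof -
  have "bits (jdead j) \<le> input_size x" if "j \<in> set (jobs x)" for j
    using member_le_sum_list[of _ "map (\<lambda>j. 1 + bits (jproc j) + bits (jrel j) + bits (jdead j)) (jobs x)"] that
    by (force simp: input_size_def)
  moreover have "horizon I \<in> insert 0 (jdead ` set (jobs x))"
    unfolding result_horizonC_jobs[symmetric] result_horizonC by (intro Max_in) auto
  moreover have "bits 0 = 0"
    by (simp add: bits_def floorlog_def)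
  ultimately have "bits (horizon I) \<le> input_size x"
    by auto
  moreover have "bits k \<le> bits (horizon I)"
    using assms by (simp add: bits_def floorlog_mono)
  ultimately show ?thesis by linarith
qed

lemma steps_prim_le:
  assumes "k \<le> horizon I" and "l \<le> horizon I"
  shows "steps (addC k l) \<le> 2 * input_size x + 1" "steps (subC k l) \<le> 2 * input_size x + 1"
    "steps (lessC k l) \<le> 2 * input_size x + 1"
  using assms[THEN bits_le] by (auto simp: addC_def subC_def lessC_def)

lemma job_le_horizon:
  assumes "j \<in> set (jobs x)"
  shows "jproc j \<le> horizon I" "jrel j \<le> horizon I" "jdead j \<le> horizon I"
  using jdead_le_horizon[OF assms] jobD(8)[OF assms] by auto

lemma steps_latestC_le: "j \<in> set (jobs x) \<Longrightarrow> steps (latestC j) \<le> 2 * input_size x + 1"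
  using steps_prim_le(2)[OF job_le_horizon(3,1)] by (simp add: latestC_def)

lemma steps_horizonC_le: "steps (horizonC (jobs x)) \<le> input_size x * (2 * input_size x + 2) + 1"
proof -
  have "result (horizonC (jobs x)) \<le> horizon I \<and>
      steps (horizonC (jobs x)) \<le> input_size x * (2 * input_size x + 2) + 1"
    unfolding horizonC_def
  proof (rule foldC_invariant[where P = "\<lambda>m. m \<le> horizon I", OF length_jobs_le])
    fix j m assume "j \<in> set (jobs x)" "m \<le> horizon I"
    then show "result (bind_costed (lessC m (jdead j)) (\<lambda>b. ret (if b then jdead j else m))) \<le> horizon I \<and>
        steps (bind_costed (lessC m (jdead j)) (\<lambda>b. ret (if b then jdead j else m))) \<le> 2 * input_size x + 2"
      using steps_prim_le(3)[of m "jdead j"] by (simp add: job_le_horizon)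
  qed simp
  then show ?thesis ..
qed

text \<open>The invariant keeps the list strictly increasing with entries among the latest starts,
  so it never has more entries than there are jobs.\<close>

lemma steps_thresholdsC_le: "steps (thresholdsC (jobs x) (horizon I)) \<le> thresholds_bound (input_size x)"
proof -
  let ?n = "input_size x"
  let ?step = "\<lambda>j ts. bind_costed (latestC j) (\<lambda>l. insertC l ts)"
  let ?L = "(\<lambda>j. jdead j - jproc j) ` set (jobs x)"
  define P where "P ts \<longleftrightarrow> sorted_wrt (<) ts \<and> set ts \<subseteq> ?L" for ts
  have len: "length ts \<le> ?n" if "P ts" for ts
  proof -
    have "length ts \<le> card ?L"
      using that by (intro length_le_card) (auto simp: P_def strict_sorted_iff)
    also have "\<dots> \<le> length (jobs x)"
      by (metis card_image_le card_length finite_set order.trans)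
    finally show ?thesis using length_jobs_le by linarith
  qed
  have small: "l \<le> horizon I" if "l \<in> ?L" for l
    using that job_le_horizon(3) by fastforce
  have step: "P (result (?step j ts)) \<and> steps (?step j ts) \<le> 2 * ?n + 1 + (?n + 1) * (4 * ?n + 3)"
    if "j \<in> set (jobs x)" "P ts" for j ts
  proof
    show "P (result (?step j ts))"
      using that by (auto simp: P_def sorted_insertC)
    have "steps (insertC (jdead j - jproc j) ts) \<le> (?n + 1) * (4 * ?n + 3)"
      using that len[OF that(2)] by (intro steps_insertC_le bits_le small) (auto simp: P_def)
    then show "steps (?step j ts) \<le> 2 * ?n + 1 + (?n + 1) * (4 * ?n + 3)"
      using steps_latestC_le[OF that(1)] by simp
  qed
  have "P []" by (simp add: P_def)
  have fold: "P (result (foldC ?step (jobs x) [])) \<and>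
      steps (foldC ?step (jobs x) []) \<le> ?n * (2 * ?n + 1 + (?n + 1) * (4 * ?n + 3)) + 1"
    by (rule foldC_invariant[where P = P, OF length_jobs_le \<open>P []\<close>]) (rule step)
  from len[OF fold[THEN conjunct1]] fold[THEN conjunct2] show ?thesis
    by (simp add: thresholdsC_def thresholds_bound_def del: result_foldC)
qed

lemma steps_candC_le:
  assumes "t \<le> horizon I"
  shows "steps (candC (jobs x) t) \<le> input_size x * (4 * input_size x + 4) + 1"
proof -
  let ?n = "input_size x"
  have "steps (candC (jobs x) t) \<le> ?n * ((4 * ?n + 3) + 1) + 1"
    unfolding candC_def
  proof (rule steps_mapC_le[OF length_jobs_le])
    fix j assume j: "j \<in> set (jobs x)"
    have "jdead j - jproc j \<le> horizon I"
      using job_le_horizon(3)[OF j] by linarith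
    then show "steps (bind_costed (latestC j) (\<lambda>l. bind_costed (lessC l t)
        (\<lambda>b. ret (j, if b then jrel j else l)))) \<le> 4 * ?n + 3"
      using steps_latestC_le[OF j] steps_prim_le(3)[of "jdead j - jproc j" t] assms by simp
  qed
  then show ?thesis by (simp add: algebra_simps)
qed

text \<open>The reached list stays a duplicate-free list of vertices, so each membership test is
  linear in the input size.\<close>

lemma steps_reachC_le:
  assumes "set js \<subseteq> set (jobs x)" and "length js \<le> input_size x"
  shows "steps (reachC x js) \<le> reach_bound (input_size x)"
proof -
  let ?n = "input_size x"
  define P where "P R \<longleftrightarrow> distinct R \<and> set R \<subseteq> verts I" for R
  have len: "length R \<le> ?n" if "P R" for R
  proof -
    have "length R \<le> card (verts I)"
      using that wf by (intro length_le_card) (auto simp: P_def wf_instance_def)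
    then show ?thesis using length_vlist length_vlist_le by simp
  qed
  have round: "P (result (roundC js R)) \<and> steps (roundC js R) \<le> ?n * (2 * ?n + 3) + 1" if "P R" for R
    unfolding roundC_def
  proof (rule foldC_invariant[where P = P, OF assms(2) that])
    fix j R assume j: "j \<in> set js" and R: "P R"
    let ?step = "bind_costed (memC (jend1 j) R) (\<lambda>b1. bind_costed (memC (jend2 j) R)
      (\<lambda>b2. ret (if b1 \<and> \<not> b2 then jend2 j # R else if b2 \<and> \<not> b1 then jend1 j # R else R)))"
    have "P (result ?step)"
      using j R jobD(2,3)[of j] assms(1) by (auto simp: P_def)
    moreover have "steps ?step \<le> 2 * ?n + 3"
      using len[OF R] steps_memC_le[of "jend1 j" R] steps_memC_le[of "jend2 j" R] by simp
    ultimately show "P (result ?step) \<and> steps ?step \<le> 2 * ?n + 3" ..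
  qed
  have "P [source x]"
    using wf enc by (auto simp: P_def wf_instance_def encodes_def)
  have fold: "P (result (foldC (\<lambda>_. roundC js) (vlist x) [source x])) \<and>
      steps (foldC (\<lambda>_. roundC js) (vlist x) [source x]) \<le> ?n * (?n * (2 * ?n + 3) + 1) + 1"
    by (rule foldC_invariant[where P = P, OF length_vlist_le \<open>P [source x]\<close>]) (rule round)
  then show ?thesis
    using len[OF fold[THEN conjunct1]]
      steps_memC_le[of "target x" "result (foldC (\<lambda>_. roundC js) (vlist x) [source x])"]
    by (simp add: reachC_def reach_bound_def del: result_foldC)
qed

section \<open>Cost of evaluating one schedule\<close>

context
  fixes \<sigma> :: "('v, 'e) job \<Rightarrow> nat"
  assumes \<sigma>: "\<And>j. j \<in> set (jobs x) \<Longrightarrow> \<sigma> j + jproc j \<le> jdead j"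
begin

abbreviation (input) schedule_list :: "(('v, 'e) job \<times> nat) list" where
  "schedule_list \<equiv> map (\<lambda>j. (j, \<sigma> j)) (jobs x)"

lemma finish_le_horizon: "j \<in> set (jobs x) \<Longrightarrow> \<sigma> j + jproc j \<le> horizon I"
  using \<sigma> job_le_horizon(3) by (meson order.trans)

lemma start_le_horizon: "j \<in> set (jobs x) \<Longrightarrow> \<sigma> j \<le> horizon I"
  using finish_le_horizon by fastforce

lemma steps_connectedC_le:
  assumes "a \<le> horizon I"
  shows "steps (connectedC x schedule_list a) \<le> connected_bound (input_size x)"
proof -
  let ?n = "input_size x"
  let ?free = "result (filterC (freeC a) schedule_list)"
  have "steps (filterC (freeC a) schedule_list) \<le> ?n * ((6 * ?n + 4) + 1) + 1"
  proof (rule steps_filterC_le)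
    fix js assume "js \<in> set schedule_list"
    then obtain j where j: "j \<in> set (jobs x)" "js = (j, \<sigma> j)" by auto
    note prims = steps_prim_le(3)[OF assms start_le_horizon[OF j(1)]]
      steps_prim_le(1)[OF start_le_horizon[OF j(1)] job_le_horizon(1)[OF j(1)]]
      steps_prim_le(3)[OF assms finish_le_horizon[OF j(1)]]
    \<comment> \<open>Three primitives at \<open>2 * ?n + 1\<close> each and one
      \<open>ret\<close>.\<close>
    show "steps (freeC a js) \<le> 6 * ?n + 4"
      using prims by (simp add: freeC_def j(2))
  qed (simp add: length_jobs_le)
  moreover have len: "length ?free \<le> ?n"
    unfolding result_filterC by (rule order.trans[OF length_filter_le]) (simp add: length_jobs_le)
  moreover have "steps (mapC (\<lambda>js. ret (fst js)) ?free) \<le> ?n * (1 + 1) + 1"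
    by (rule steps_mapC_le[OF len]) simp
  moreover have "steps (reachC x (map fst ?free)) \<le> reach_bound ?n"
    using len by (intro steps_reachC_le) auto
  ultimately show ?thesis
    by (simp add: connectedC_def connected_bound_def add.commute)
qed

text \<open>The invariant confines a strictly increasing list to 0, the horizon and two times per
  job, which gives at most \<open>2 * input_size x + 2\<close> events.\<close>

lemma steps_eventsC_le:
  shows "steps (eventsC schedule_list (horizon I)) \<le> events_bound (input_size x)"
    and length_eventsC_le: "length (result (eventsC schedule_list (horizon I))) \<le> 2 * input_size x + 2"
    and eventsC_le_horizon: "\<And>k. k \<in> set (result (eventsC schedule_list (horizon I))) \<Longrightarrow> k \<le> horizon I"
proof -
  let ?n = "input_size x"
  let ?E = "set (0 # horizon I # map \<sigma> (jobs x) @ map (\<lambda>j. \<sigma> j + jproc j) (jobs x))"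
  let ?step = "\<lambda>js ev. bind_costed (addC (snd js) (jproc (fst js))) (\<lambda>c.
      bind_costed (insertC (snd js) ev) (\<lambda>ev1. insertC c ev1))"
  define P where "P ev \<longleftrightarrow> sorted_wrt (<) ev \<and> set ev \<subseteq> ?E" for ev
  have small: "k \<le> horizon I" if "k \<in> ?E" for k
    using that start_le_horizon finish_le_horizon by auto
  have len: "length ev \<le> 2 * ?n + 2" if "P ev" for ev
  proof -
    have "length ev \<le> card ?E"
      using that by (intro length_le_card) (auto simp: P_def strict_sorted_iff)
    also have "\<dots> \<le> 2 * length (jobs x) + 2"
      by (rule order.trans[OF card_length]) simp
    finally show ?thesis using length_jobs_le by linarith
  qed
  have insert: "P (result (insertC k ev)) \<and> steps (insertC k ev) \<le> (2 * ?n + 3) * (4 * ?n + 3)"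
    if "P ev" "k \<in> ?E" for k ev
  proof
    show "P (result (insertC k ev))"
      using that by (auto simp: P_def sorted_insertC)
    have "steps (insertC k ev) \<le> (2 * ?n + 2 + 1) * (4 * ?n + 3)"
      using that len[OF that(1)] by (intro steps_insertC_le bits_le small) (auto simp: P_def)
    then show "steps (insertC k ev) \<le> (2 * ?n + 3) * (4 * ?n + 3)"
      by (simp add: algebra_simps)
  qed
  have "P [0]" by (simp add: P_def)
  then have init: "P (result (insertC (horizon I) [0]))"
    by (rule insert[THEN conjunct1]) simp
  have init_cost: "steps (insertC (horizon I) [0]) \<le> 2 * (4 * ?n + 3)"
    using steps_insertC_le[of "horizon I" ?n "[0]" 1] bits_le by simp
  have step: "P (result (?step js ev)) \<and>
      steps (?step js ev) \<le> 2 * ?n + 1 + 2 * ((2 * ?n + 3) * (4 * ?n + 3))"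
    if "js \<in> set schedule_list" "P ev" for js ev
  proof -
    from that(1) obtain j where j: "j \<in> set (jobs x)" "js = (j, \<sigma> j)" by auto
    then have mem: "\<sigma> j \<in> ?E" "\<sigma> j + jproc j \<in> ?E" by auto
    note first = insert[OF that(2) mem(1)]
    note second = insert[OF first[THEN conjunct1] mem(2)]
    have "steps (addC (\<sigma> j) (jproc j)) \<le> 2 * ?n + 1"
      by (intro steps_prim_le start_le_horizon job_le_horizon j(1))
    with first second show ?thesis by (simp add: j(2))
  qed
  have len_S: "length schedule_list \<le> ?n" by (simp add: length_jobs_le)
  have fold: "P (result (foldC ?step schedule_list (result (insertC (horizon I) [0])))) \<and>
    steps (foldC ?step schedule_list (result (insertC (horizon I) [0]))) \<le>
      ?n * (2 * ?n + 1 + 2 * ((2 * ?n + 3) * (4 * ?n + 3))) + 1"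
    by (rule foldC_invariant[where P = P, OF len_S init]) (rule step)
  show "steps (eventsC schedule_list (horizon I)) \<le> events_bound (input_size x)"
    using init_cost fold by (simp add: eventsC_def events_bound_def)
  have P: "P (result (eventsC schedule_list (horizon I)))"
    using fold by (simp add: eventsC_def)
  show "length (result (eventsC schedule_list (horizon I))) \<le> 2 * input_size x + 2"
    by (rule len[OF P])
  show "k \<le> horizon I" if "k \<in> set (result (eventsC schedule_list (horizon I)))" for k
    using P that small unfolding P_def by blast
qed

lemma result_sweepC_le_horizon:
  assumes "sorted_wrt (<) ev" and "\<And>k. k \<in> set ev \<Longrightarrow> k \<le> horizon I"
  shows "result (sweepC x S ev) \<le> horizon I"
proof (cases "ev = []")
  case False
  then have "result (sweepC x S ev) \<le> last ev"
    using sweepC_le[OF assms(1) False, of x S] by linarith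
  then show ?thesis using assms(2)[of "last ev"] False by simp
qed simp

lemma steps_sweepC_le:
  assumes "sorted_wrt (<) ev" and "\<And>k. k \<in> set ev \<Longrightarrow> k \<le> horizon I"
  shows "steps (sweepC x schedule_list ev) \<le>
    length ev * (connected_bound (input_size x) + 4 * input_size x + 2) + 1"
  using assms
proof (induction ev rule: induct_list012)
  case (3 a b ev)
  have le: "a \<le> horizon I" "b \<le> horizon I" "b - a \<le> horizon I"
    using 3(4)[of a] 3(4)[of b] by auto
  have tail: "sorted_wrt (<) (b # ev)" "\<And>k. k \<in> set (b # ev) \<Longrightarrow> k \<le> horizon I"
    using 3(3,4) by auto
  let ?r = "result (sweepC x schedule_list (b # ev))"
  \<comment> \<open>The partial sum \<open>?r\<close> is at most the horizon, so the addition has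
    operands of bounded binary length.\<close>
  have "steps (subC b a) \<le> 2 * input_size x + 1" "steps (addC (b - a) ?r) \<le> 2 * input_size x + 1"
    by (intro steps_prim_le le result_sweepC_le_horizon[OF tail])+
  with 3(2)[OF tail] steps_connectedC_le[OF le(1)] show ?case
    by simp
qed simp_all

lemma steps_conn_timeC_le:
  "steps (conn_timeC x (horizon I) schedule_list) \<le> events_bound (input_size x) +
     ((2 * input_size x + 2) * (connected_bound (input_size x) + 4 * input_size x + 2) + 1)"
proof -
  let ?n = "input_size x"
  let ?ev = "result (eventsC schedule_list (horizon I))"
  have "steps (sweepC x schedule_list ?ev) \<le> length ?ev * (connected_bound ?n + 4 * ?n + 2) + 1"
    by (rule steps_sweepC_le[OF result_eventsC(1) eventsC_le_horizon])
  also have "\<dots> \<le> (2 * ?n + 2) * (connected_bound ?n + 4 * ?n + 2) + 1"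
    by (intro add_mono mult_le_mono length_eventsC_le order.refl)
  finally show ?thesis
    using steps_eventsC_le by (simp add: conn_timeC_def)
qed

lemma result_conn_timeC_le: "result (conn_timeC x (horizon I) schedule_list) \<le> horizon I"
  using result_sweepC_le_horizon[OF result_eventsC(1) eventsC_le_horizon]
  by (simp add: conn_timeC_def)

end

section \<open>Cost of the whole algorithm\<close>

lemma evaluateC_le:
  assumes "t \<le> horizon I"
  shows "steps (evaluateC x (horizon I) t) \<le> evaluate_bound (input_size x)"
    and "snd (result (evaluateC x (horizon I) t)) \<le> horizon I"
    and "length (fst (result (evaluateC x (horizon I) t))) \<le> input_size x"
  using steps_candC_le[OF assms] steps_conn_timeC_le[of "cand_start t", OF cand_start_le]
    result_conn_timeC_le[of "cand_start t", OF cand_start_le] length_jobs_le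
  by (simp_all add: evaluateC_def evaluate_bound_def result_candC)

lemma steps_best_candidate_le: "steps (best_candidate x) \<le> best_bound (input_size x)"
proof -
  let ?n = "input_size x"
  let ?ts = "result (thresholdsC (jobs x) (horizon I))"
  let ?step = "\<lambda>t best. bind_costed (evaluateC x (horizon I) t) (\<lambda>new.
      bind_costed (lessC (snd best) (snd new)) (\<lambda>better. ret (if better then new else best)))"
  \<comment> \<open>The bound on the value keeps the comparisons cheap, the bound on the list the
    final \<open>mapC\<close>.\<close>
  define P where "P b \<longleftrightarrow> snd b \<le> horizon I \<and> length (fst b) \<le> ?n"
    for b :: "(('v, 'e) job \<times> nat) list \<times> nat"
  have ts: "t \<le> horizon I" if "t \<in> set ?ts" for t
    using that job_le_horizon(3) by (fastforce simp: result_thresholdsC)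
  have "?ts \<noteq> []" by (simp add: result_thresholdsC)
  then have first: "hd ?ts \<le> horizon I" by (intro ts) simp
  then have P_first: "P (result (evaluateC x (horizon I) (hd ?ts)))"
    by (simp add: P_def evaluateC_le)
  \<comment> \<open>The head is evaluated before the loop, so the loop runs once per distinct latest
    start short of counting the horizon twice: the tail has one entry fewer than the
    \<open>num_latest I + 1\<close> thresholds.\<close>
  have len_ts: "length (tl ?ts) \<le> ?n"
  proof -
    have "length (tl ?ts) = card ((\<lambda>j. jdead j - jproc j) ` set (jobs x))"
      by (simp add: result_thresholdsC)
    also have "\<dots> \<le> length (jobs x)"
      by (metis card_image_le card_length finite_set order.trans)
    finally show ?thesis using length_jobs_le by linarith
  qed
  have step: "P (result (?step t b)) \<and> steps (?step t b) \<le> evaluate_bound ?n + 2 * ?n + 2"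
    if "t \<in> set (tl ?ts)" "P b" for t b
  proof -
    have "t \<le> horizon I"
      using that(1) by (intro ts) (meson list.set_sel(2) \<open>?ts \<noteq> []\<close>)
    note new = evaluateC_le[OF this]
    have "steps (lessC (snd b) (snd (result (evaluateC x (horizon I) t)))) \<le> 2 * ?n + 1"
      using that(2) by (intro steps_prim_le new) (simp add: P_def)
    then show ?thesis
      using new that(2) by (simp add: P_def)
  qed
  have fold: "P (result (foldC ?step (tl ?ts) (result (evaluateC x (horizon I) (hd ?ts))))) \<and>
      steps (foldC ?step (tl ?ts) (result (evaluateC x (horizon I) (hd ?ts)))) \<le>
      ?n * (evaluate_bound ?n + 2 * ?n + 2) + 1"
    by (rule foldC_invariant[where P = P, OF len_ts P_first]) (rule step)
  then have "steps (mapC (\<lambda>js. ret (jid (fst js), snd js))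
      (fst (result (foldC ?step (tl ?ts) (result (evaluateC x (horizon I) (hd ?ts))))))) \<le> ?n * (1 + 1) + 1"
    unfolding P_def by (intro steps_mapC_le) auto
  then show ?thesis
    using fold steps_horizonC_le steps_thresholdsC_le evaluateC_le(1)[OF first]
    by (simp add: best_candidate_def best_bound_def result_horizonC_jobs del: result_foldC)
qed

end

lemma polynomial_time_best_candidate:
  "polynomial_time (best_candidate :: ('v, 'e) input \<Rightarrow> ('e \<times> nat) list costed)"
  unfolding polynomial_time_def
proof (intro exI allI impI)
  fix I :: "('v, 'e) maint_instance" and x :: "('v, 'e) input"
  assume "wf_instance I" "encodes x I"
  then interpret encoded_instance x I by unfold_locales
  show "steps (best_candidate x) \<le> poly (best_bound [:0, 1:]) (input_size x)"
    using steps_best_candidate_le by (simp add: poly_best_bound)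
qed

theorem theorem6:
  "(\<forall>I :: ('v, 'e) maint_instance. wf_instance I \<longrightarrow>
      num_latest I \<le> card (edges I) \<and>
      (\<forall>i. best_index I i \<longrightarrow> approx_solution (real (num_latest I + 1)) I (cand I i)) \<and>
      (\<forall>x. encodes x I \<longrightarrow>
         (\<exists>i. best_index I i \<and>
              (\<forall>e\<in>edges I. schedule_of (result (best_candidate x)) e = cand I i e)))) \<and>
   approx_algorithm (\<lambda>I :: ('v, 'e) maint_instance. real (num_latest I + 1)) best_candidate \<and>
   polynomial_time (best_candidate :: ('v, 'e) input \<Rightarrow> ('e \<times> nat) list costed)"
proof (intro conjI allI impI)
  fix I :: "('v, 'e) maint_instance"
  assume wf: "wf_instance I"
  show "num_latest I \<le> card (edges I)"
    using wf by (auto simp: num_latest_def wf_instance_def intro: card_image_le)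
  show "approx_solution (real (num_latest I + 1)) I (cand I i)" if "best_index I i" for i
    by (rule approx_solution_best_index[OF wf that])
  show "\<exists>i. best_index I i \<and> (\<forall>e\<in>edges I. schedule_of (result (best_candidate x)) e = cand I i e)"
    if "encodes x I" for x
    using wf that by (intro encoded_instance.schedule_of_best_candidate encoded_instance.intro)
next
  show "approx_algorithm (\<lambda>I :: ('v, 'e) maint_instance. real (num_latest I + 1)) best_candidate"
    unfolding approx_algorithm_def
  proof (intro allI impI)
    fix I :: "('v, 'e) maint_instance" and x :: "('v, 'e) input"
    assume "wf_instance I" "encodes x I"
    then interpret encoded_instance x I by unfold_locales
    obtain i where i: "best_index I i"
        "\<forall>e\<in>edges I. schedule_of (result (best_candidate x)) e = cand I i e"
      using schedule_of_best_candidate by blast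
    \<comment> \<open>The output agrees with the best candidate on edges, which is all that
      \<open>approx_solution\<close> depends on.\<close>
    have "approx_solution (real (num_latest I + 1)) I (schedule_of (result (best_candidate x)))"
      using approx_solution_cong[OF i(2)] approx_solution_best_index[OF wf i(1)] by simp
    moreover have "fst ` set (result (best_candidate x)) = edges I"
      by (metis fst_best_candidate set_map edges_eq)
    ultimately show "distinct (map fst (result (best_candidate x))) \<and>
        fst ` set (result (best_candidate x)) = edges I \<and>
        approx_solution (real (num_latest I + 1)) I (schedule_of (result (best_candidate x)))"
      using distinct_jid by (simp add: fst_best_candidate)
  qed
qed (rule polynomial_time_best_candidate)

end
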